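(* Let $U=I+U_s\in\mathbb{C}^{n\times n}$, with $I$ the identity matrix and $U_s$ strictly upper triangular. If $U$ is nearly (row) diagonally dominant with associated constant $\delta$, then $$dep(U)\le\sqrt n\,(1+\delta).$$
   Context: For $A\in\mathbb{C}^{n\times n}$, Henrici's departure from normality is $dep(A)=\sqrt{\|A\|_F^2-\|D\|_F^2}$, where $D\in\mathbb{C}^{n\times n}$ is the diagonal matrix containing the eigenvalues of $A$ (with multiplicity) and $\|\cdot\|_F$ is the Frobenius norm. Near diagonal dominance: for $U=(u_{ij})\in\mathbb{C}^{n\times n}$, let $\delta=\max_i\delta_i$, where $\delta_i>0$ is such that $|u_{ii}|\ge\sum_{j\ne i}|u_{ij}|-\delta_i$ for all $i=1,\dots,n$. The matrix $U$ is nearly (row) diagonally dominant (with constant $\delta$) if and only if $|u_{ii}|\ge\sum_{j\neq i}|u_{ij}|-\delta$ for all $i=1,\dots,n$. *)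

theory Defs
  imports "Jordan_Normal_Form.Char_Poly"
begin

definition frobenius_norm :: "complex mat \<Rightarrow> real" where
  "frobenius_norm A = sqrt (\<Sum>i<dim_row A. \<Sum>j<dim_col A. (cmod (A $$ (i, j)))\<^sup>2)"

text \<open>Multiplicities are algebraic: \<^const>\<open>proots\<close> lists each root of the
  characteristic polynomial according to its order. The order of the eigenvalues along the
  diagonal is left open.\<close>

definition eigenvalue_diagonal :: "complex mat \<Rightarrow> complex mat \<Rightarrow> bool" where
  "eigenvalue_diagonal A D \<longleftrightarrow>
     D \<in> carrier_mat (dim_row A) (dim_col A) \<and> diagonal_mat D \<and>
     mset (diag_mat D) = proots (char_poly A)"

text \<open>Henrici's departure from normality. The choice of \<open>D\<close> is immaterial, see
  \<open>departure_from_normality_eq\<close> and \<open>ex_eigenvalue_diagonal\<close> below. By Schur's inequality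
  the radicand is nonnegative, so the convention for \<^const>\<open>sqrt\<close> on negative reals
  plays no role.\<close>

definition departure_from_normality :: "complex mat \<Rightarrow> real" where
  "departure_from_normality A =
     sqrt ((frobenius_norm A)\<^sup>2 - (frobenius_norm (SOME D. eigenvalue_diagonal A D))\<^sup>2)"

definition strictly_upper_triangular :: "'a::zero mat \<Rightarrow> bool" where
  "strictly_upper_triangular A \<longleftrightarrow>
     (\<forall>i<dim_row A. \<forall>j<dim_col A. j \<le> i \<longrightarrow> A $$ (i, j) = 0)"

text \<open>The constant arises as the maximum of positive row constants, hence the positivity
  requirement; see \<open>nearly_row_diag_dominant_iff\<close> below.\<close>

definition nearly_row_diag_dominant :: "real \<Rightarrow> complex mat \<Rightarrow> bool" where
  "nearly_row_diag_dominant \<delta> U \<longleftrightarrow> 0 < \<delta> \<and>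
     (\<forall>i<dim_row U.
        cmod (U $$ (i, i)) \<ge> (\<Sum>j\<in>{..<dim_col U} - {i}. cmod (U $$ (i, j))) - \<delta>)"

lemma ex_eigenvalue_diagonal:
  assumes A: "A \<in> carrier_mat n n"
  shows "\<exists>D. eigenvalue_diagonal A D"
proof -
  obtain as where as: "char_poly A = (\<Prod>a\<leftarrow>as. [:- a, 1:])" and len: "length as = n"
    using char_poly_factorized[OF A] by blast
  have "proots (\<Prod>a\<leftarrow>as. [:- a, 1:]) = mset as" for as :: "complex list"
  proof (induction as)
    case (Cons a as)
    have "(\<Prod>a\<leftarrow>as. [:- a, 1:]) \<noteq> 0"
      by (auto simp: prod_list_zero_iff)
    moreover have "[:- a, 1:] \<noteq> 0" by simp
    ultimately have "proots ([:- a, 1:] * (\<Prod>a\<leftarrow>as. [:- a, 1:]))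
        = {#a#} + proots (\<Prod>a\<leftarrow>as. [:- a, 1:])"
      by (subst proots_mult) simp_all
    with Cons show ?case by simp
  qed simp
  then have pr: "proots (char_poly A) = mset as" by (simp add: as)
  have "diag_mat (mat_diag n (\<lambda>i. as ! i)) = as"
    by (rule nth_equalityI) (auto simp: diag_mat_def mat_diag_def len)
  then have "eigenvalue_diagonal A (mat_diag n (\<lambda>i. as ! i))"
    using A by (auto simp: eigenvalue_diagonal_def diagonal_mat_def mat_diag_def pr)
  then show ?thesis ..
qed

lemma frobenius_norm_eigenvalue_diagonal:
  assumes A: "A \<in> carrier_mat n n" and D: "eigenvalue_diagonal A D"
  shows "(frobenius_norm D)\<^sup>2 = (\<Sum>z\<in>#proots (char_poly A). (cmod z)\<^sup>2)"
proof -
  have dim: "dim_row D = n" "dim_col D = n" and diag: "diagonal_mat D"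
    and ms: "mset (diag_mat D) = proots (char_poly A)"
    using A D by (auto simp: eigenvalue_diagonal_def)
  have "(\<Sum>j<n. (cmod (D $$ (i, j)))\<^sup>2) = (cmod (D $$ (i, i)))\<^sup>2" if "i < n" for i
  proof -
    have "(\<Sum>j<n. (cmod (D $$ (i, j)))\<^sup>2)
        = (\<Sum>j<n. if j = i then (cmod (D $$ (i, i)))\<^sup>2 else 0)"
      using diag that by (intro sum.cong) (auto simp: diagonal_mat_def dim)
    then show ?thesis using that by simp
  qed
  then have "(frobenius_norm D)\<^sup>2 = (\<Sum>i<n. (cmod (D $$ (i, i)))\<^sup>2)"
    by (simp add: frobenius_norm_def dim sum_nonneg)
  also have "\<dots> = (\<Sum>z\<leftarrow>diag_mat D. (cmod z)\<^sup>2)"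
    by (simp add: diag_mat_def dim comp_def interv_sum_list_conv_sum_set_nat lessThan_atLeast0)
  also have "\<dots> = (\<Sum>z\<in>#mset (diag_mat D). (cmod z)\<^sup>2)"
    by (metis mset_map sum_mset_sum_list)
  finally show ?thesis by (simp add: ms)
qed

lemma departure_from_normality_eq:
  assumes A: "A \<in> carrier_mat n n" and D: "eigenvalue_diagonal A D"
  shows "departure_from_normality A = sqrt ((frobenius_norm A)\<^sup>2 - (frobenius_norm D)\<^sup>2)"
proof -
  have "eigenvalue_diagonal A (SOME D. eigenvalue_diagonal A D)"
    using D by (rule someI)
  then show ?thesis
    using frobenius_norm_eigenvalue_diagonal[OF A] D
    by (simp add: departure_from_normality_def)
qed

lemma nearly_row_diag_dominant_iff:
  assumes U: "U \<in> carrier_mat n n" and n: "0 < n"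
  shows "nearly_row_diag_dominant \<delta> U \<longleftrightarrow>
    (\<exists>d. (\<forall>i<n. 0 < d i \<and>
            cmod (U $$ (i, i)) \<ge> (\<Sum>j\<in>{..<n} - {i}. cmod (U $$ (i, j))) - d i) \<and>
         \<delta> = Max (d ` {..<n}))" (is "?L \<longleftrightarrow> (\<exists>d. ?P d)")
proof
  assume L: ?L
  have "(\<lambda>_. \<delta>) ` {..<n} = {\<delta>}" using n by auto
  then have "?P (\<lambda>_. \<delta>)" using L U by (simp add: nearly_row_diag_dominant_def)
  then show "\<exists>d. ?P d" by (intro exI[where x = "\<lambda>_. \<delta>"])
next
  assume "\<exists>d. ?P d"
  then obtain d where d: "?P d" by blast
  have le: "d i \<le> \<delta>" if "i < n" for i using d that by simp
  have "0 < d 0" using d n by simp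
  also have "d 0 \<le> \<delta>" using n by (rule le)
  finally have "0 < \<delta>" .
  moreover have "cmod (U $$ (i, i)) \<ge> (\<Sum>j\<in>{..<n} - {i}. cmod (U $$ (i, j))) - \<delta>"
    if "i < n" for i
  proof -
    have "(\<Sum>j\<in>{..<n} - {i}. cmod (U $$ (i, j))) - d i \<le> cmod (U $$ (i, i))"
      using d that by blast
    with le[OF that] show ?thesis by linarith
  qed
  ultimately show ?L using U by (simp add: nearly_row_diag_dominant_def)
qed

end

theory Submission
  imports Defs "HOL-Analysis.L2_Norm"
begin

text \<open>The eigenvalues of an upper triangular matrix are its diagonal entries, so subtracting
  their squared moduli from the squared Frobenius norm removes exactly the diagonal: the departure
  from normality of \<open>D + N\<close>, with \<open>D\<close> diagonal and \<open>N\<close> strictly upper triangular, is the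
  Frobenius norm of \<open>N\<close> (\<open>departure_diagonal_plus_strictly_upper\<close>). For a unit diagonal, near
  diagonal dominance says that each row of \<open>N\<close> has \<open>\<ell>\<^sup>1\<close> norm at most \<open>1 + \<delta>\<close>. The \<open>\<ell>\<^sup>2\<close> norm of a
  row is at most its \<open>\<ell>\<^sup>1\<close> norm, so the \<open>n\<close> rows contribute at most \<open>n (1 + \<delta>)\<^sup>2\<close> to the squared
  Frobenius norm (\<open>frobenius_norm_le_row_sums\<close>).\<close>

lemma proots_prod_list_linear:
  fixes as :: "'a::idom list"
  shows "proots (\<Prod>a\<leftarrow>as. [:- a, 1:]) = mset as"
proof (induction as)
  case (Cons a as)
  have "(\<Prod>a\<leftarrow>as. [:- a, 1:]) \<noteq> 0"
    by (auto simp: prod_list_zero_iff)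
  then have "proots ([:- a, 1:] * (\<Prod>a\<leftarrow>as. [:- a, 1:]))
      = {#a#} + proots (\<Prod>a\<leftarrow>as. [:- a, 1:])"
    by (subst proots_mult) simp_all
  with Cons show ?case by simp
qed simp

lemma eigenvalue_diagonal_diagonal_plus_strictly_upper:
  assumes N: "N \<in> carrier_mat n n" and upper: "strictly_upper_triangular N"
  shows "eigenvalue_diagonal (mat_diag n d + N) (mat_diag n d)"
proof -
  let ?A = "mat_diag n d + N"
  have A: "?A \<in> carrier_mat n n" using N by simp
  have "upper_triangular ?A"
    using N upper
    by (auto simp: upper_triangular_def strictly_upper_triangular_def mat_diag_def)
  from char_poly_upper_triangular[OF A this]
  have "proots (char_poly ?A) = mset (diag_mat ?A)"
    by (simp add: proots_prod_list_linear)
  also have "diag_mat ?A = diag_mat (mat_diag n d)"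
    using N upper
    by (auto simp: diag_mat_def strictly_upper_triangular_def mat_diag_def)
  finally show ?thesis
    using N by (auto simp: eigenvalue_diagonal_def diagonal_mat_def mat_diag_def)
qed

text \<open>The supports of \<open>D\<close> and \<open>N\<close> are disjoint, so squared Frobenius norms add up as in
  Pythagoras' theorem.\<close>

lemma departure_diagonal_plus_strictly_upper:
  assumes N: "N \<in> carrier_mat n n" and upper: "strictly_upper_triangular N"
  shows "departure_from_normality (mat_diag n d + N) = frobenius_norm N"
proof -
  let ?D = "mat_diag n d"
  have A: "?D + N \<in> carrier_mat n n" using N by simp
  have entry: "(cmod ((?D + N) $$ (i, j)))\<^sup>2 = (cmod (?D $$ (i, j)))\<^sup>2 + (cmod (N $$ (i, j)))\<^sup>2"
    if "i < n" "j < n" for i j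
    using that N upper by (auto simp: strictly_upper_triangular_def mat_diag_def)
  have "(frobenius_norm (?D + N))\<^sup>2 = (frobenius_norm ?D)\<^sup>2 + (frobenius_norm N)\<^sup>2"
    using N carrier_matD[OF mat_diag_dim, of n d]
    by (simp add: frobenius_norm_def sum_nonneg entry sum.distrib del: index_add_mat(1))
  moreover have "frobenius_norm N \<ge> 0"
    by (simp add: frobenius_norm_def sum_nonneg)
  ultimately show ?thesis
    using departure_from_normality_eq[OF A
        eigenvalue_diagonal_diagonal_plus_strictly_upper[OF assms]]
    by simp
qed

text \<open>The \<open>\<ell>\<^sup>1\<close> norm dominates the \<open>\<ell>\<^sup>2\<close> norm within each row, and the squares of the rows add up.\<close>

lemma frobenius_norm_le_row_sums:
  assumes A: "A \<in> carrier_mat m n"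
    and row: "\<And>i. i < m \<Longrightarrow> (\<Sum>j<n. cmod (A $$ (i, j))) \<le> c"
    and c: "0 \<le> c"
  shows "frobenius_norm A \<le> sqrt (real m) * c"
proof -
  have "(\<Sum>j<n. (cmod (A $$ (i, j)))\<^sup>2) \<le> c\<^sup>2" if "i < m" for i
  proof -
    have "sqrt (\<Sum>j<n. (cmod (A $$ (i, j)))\<^sup>2) \<le> (\<Sum>j<n. cmod (A $$ (i, j)))"
      using L2_set_le_sum[of "{..<n}" "\<lambda>j. cmod (A $$ (i, j))"] by (simp add: L2_set_def)
    also have "\<dots> \<le> c" using that by (rule row)
    finally show ?thesis by (rule sqrt_le_D)
  qed
  then have "(\<Sum>i<m. \<Sum>j<n. (cmod (A $$ (i, j)))\<^sup>2) \<le> real m * c\<^sup>2"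
    using sum_bounded_above[of "{..<m}" "\<lambda>i. \<Sum>j<n. (cmod (A $$ (i, j)))\<^sup>2" "c\<^sup>2"] by simp
  then have "frobenius_norm A \<le> sqrt (real m * c\<^sup>2)"
    using A by (simp add: frobenius_norm_def)
  then show ?thesis using c by (simp add: real_sqrt_mult)
qed

theorem theorem5p5:
  fixes n :: nat and U U\<^sub>s :: "complex mat" and \<delta> :: real
  assumes "U\<^sub>s \<in> carrier_mat n n"
    and "strictly_upper_triangular U\<^sub>s"
    and "U = 1\<^sub>m n + U\<^sub>s"
    and "nearly_row_diag_dominant \<delta> U"
  shows "departure_from_normality U \<le> sqrt (real n) * (1 + \<delta>)"
proof -
  have \<delta>: "0 < \<delta>" using assms(4) by (simp add: nearly_row_diag_dominant_def)
  have row: "(\<Sum>j<n. cmod (U\<^sub>s $$ (i, j))) \<le> 1 + \<delta>" if i: "i < n" for i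
  proof -
    have diag: "U\<^sub>s $$ (i, i) = 0"
      using assms(1,2) i by (simp add: strictly_upper_triangular_def)
    have "(\<Sum>j<n. cmod (U\<^sub>s $$ (i, j))) = (\<Sum>j\<in>{..<n} - {i}. cmod (U\<^sub>s $$ (i, j)))"
      using i by (simp add: sum.remove[of "{..<n}" i] diag)
    also have "\<dots> = (\<Sum>j\<in>{..<n} - {i}. cmod (U $$ (i, j)))"
      using assms(1) i by (intro sum.cong) (auto simp: assms(3))
    also have "\<dots> \<le> cmod (U $$ (i, i)) + \<delta>"
      using assms(1,4) i by (simp add: nearly_row_diag_dominant_def assms(3) diff_le_eq)
    also have "cmod (U $$ (i, i)) = 1"
      using assms(1) i by (simp add: assms(3) diag)
    finally show ?thesis .
  qed
  have "departure_from_normality U = frobenius_norm U\<^sub>s"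
    using departure_diagonal_plus_strictly_upper[OF assms(1,2), of "\<lambda>_. 1"] assms(3) by simp
  also have "\<dots> \<le> sqrt (real n) * (1 + \<delta>)"
    using assms(1) row \<delta> by (intro frobenius_norm_le_row_sums) auto
  finally show ?thesis .
qed

end
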